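(* (Golden ratios.) The diagonal lengths $d_i$ in a regular $n$-gon, $n=p+q+r$, fulfil the equation $$\frac{d_r-d_{r-1}}{d_p}=\frac{d_{r-1}-d_{r-2}}{d_{p+1}}=\cdots=\frac{d_2-d_1}{d_{q-1}}=\frac{d_1}{d_q}=\frac{d_r}{\sum_{i=q}^{p}d_i}.$$ In the chain, the first index in the numerator decreases in steps of one from $r$ to $2$ while the index in the denominator increases in steps of one from $p$ to $q-1$.
   Context: In a regular $n$-gon, $d_i$ is the length of the chord joining two vertices that are $i$ steps apart along the polygon; thus $d_1$ is the side length, and by symmetry $d_k=d_{n-k}$. The numbers $p,q,r$ are positive integers. The sum $\sum_{i=q}^{p}d_i$ is taken over all indices from $q$ to $p$ inclusive, i.e. it is $d_p+d_{p+1}+\cdots+d_q$.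
   Formalization: The condition p + r = q + 1 (so n = 2q + 1) is made explicit: the chain is well formed only if its numerator and denominator indices run through equally many values, and without it the last equality fails, e.g. for n = 5, p = q = 1, r = 3. *)

theory Defs
  imports Complex_Main
begin

text \<open>
  The vertices of a regular \<open>n\<close>-gon in the Euclidean plane, listed counterclockwise: \<open>n\<close> equally
  spaced points on a circle with centre \<open>c\<close> and radius \<open>cmod a\<close>.  The labelling \<open>v\<close> is continued
  \<open>n\<close>-periodically to all natural numbers, so that \<open>v (j + i)\<close> is always the vertex \<open>i\<close> steps after
  \<open>v j\<close>.
\<close>

definition regular_polygon :: "nat \<Rightarrow> (nat \<Rightarrow> complex) \<Rightarrow> bool" where
  "regular_polygon n v \<longleftrightarrow>
     n \<ge> 3 \<and> (\<exists>c a. a \<noteq> 0 \<and> (\<forall>k. v k = c + a * cis (2 * pi * real k / real n)))"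

definition diagonal :: "(nat \<Rightarrow> complex) \<Rightarrow> nat \<Rightarrow> real" where
  "diagonal v i = dist (v 0) (v i)"

text \<open>
  In a regular polygon the starting vertex \<open>v 0\<close> in \<^const>\<open>diagonal\<close> is immaterial, and
  \<^const>\<open>diagonal\<close> does not vanish for the indices strictly between \<open>0\<close> and \<open>n\<close>.
\<close>

lemma diagonal_steps_apart:
  assumes "regular_polygon n v"
  shows "dist (v j) (v (j + i)) = diagonal v i"
proof -
  obtain c a where v: "\<And>k. v k = c + a * cis (2 * pi * real k / real n)"
    using assms by (auto simp: regular_polygon_def)
  have "v j - v (j + i) = cis (2 * pi * real j / real n) * (v 0 - v i)"
    by (simp add: v cis_mult algebra_simps add_divide_distrib)
  then show ?thesis
    by (simp add: diagonal_def dist_norm norm_mult)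
qed

lemma regular_polygon_periodic:
  assumes "regular_polygon n v"
  shows "v (k + n) = v k"
proof -
  obtain c a where v: "\<And>k. v k = c + a * cis (2 * pi * real k / real n)" and n: "n \<ge> 3"
    using assms by (auto simp: regular_polygon_def)
  have "2 * pi * real (k + n) / real n = 2 * pi * real k / real n + 2 * pi"
    using n by (simp add: field_simps)
  then show ?thesis
    by (simp only: v cis_mult[symmetric]) simp
qed

lemma diagonal_symmetric:
  assumes "regular_polygon n v" "k \<le> n"
  shows "diagonal v (n - k) = diagonal v k"
proof -
  have "diagonal v (n - k) = dist (v k) (v (k + (n - k)))"
    using diagonal_steps_apart[OF assms(1)] by simp
  also have "\<dots> = diagonal v k"
    using assms(2) regular_polygon_periodic[OF assms(1), of 0]
    by (simp add: diagonal_def dist_commute)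
  finally show ?thesis .
qed

lemma diagonal_pos:
  assumes "regular_polygon n v" "0 < i" "i < n"
  shows "diagonal v i > 0"
proof -
  obtain c a where v: "\<And>k. v k = c + a * cis (2 * pi * real k / real n)" and a: "a \<noteq> 0"
    using assms by (auto simp: regular_polygon_def)
  have "inj_on (\<lambda>k. cis (2 * pi * real k / real n)) {..<n}"
    using bij_betw_roots_unity[of n] assms by (auto simp: bij_betw_def)
  from inj_onD[OF this, of 0 i] show ?thesis
    using assms a by (auto simp: diagonal_def v)
qed

end

theory Submission
  imports Defs
begin

text \<open>
  The two conditions on \<open>p, q, r\<close> force \<open>n = 2 q + 1\<close>.  In a polygon with an odd number of vertices,
  consecutive differences of diagonals are again diagonals up to a single factor: since a diagonal
  is a multiple of \<open>sin (k \<pi> / n)\<close>, the gap between two consecutive ones is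
  \<open>2 sin (\<pi> / (2 n))\<close> times a cosine at a half-integral multiple of \<open>\<pi> / n\<close>, and because \<open>n / 2\<close> is
  itself a half-integer, reflecting that cosine into a sine lands on an integral multiple again, that
  is, on a diagonal (lemma \<open>diagonal_gap_odd\<close>).  Hence \<open>2 sin (\<pi> / (2 n))\<close> is the common value of
  all the ratios.  The ratio \<open>d\<^sub>1 / d\<^sub>q\<close> is the gap between \<open>d\<^sub>0 = 0\<close> and \<open>d\<^sub>1\<close>, and the ratio with
  the sum arises by adding all the gaps from \<open>d\<^sub>0\<close> to \<open>d\<^sub>r\<close>, which telescope.
\<close>

text \<open>
  The central angle of a diagonal is halved in its length: \<open>1 - cis (2 t)\<close> is \<open>cis t\<close> times the purely
  imaginary number \<open>cis (- t) - cis t\<close>.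
\<close>

lemma norm_one_minus_cis: "cmod (1 - cis (2 * t)) = 2 * \<bar>sin t\<bar>"
proof -
  have "1 - cis (2 * t) = - (2 * \<i> * complex_of_real (sin t)) * cis t"
    by (simp add: complex_eq_iff cos_double_sin sin_double power2_eq_square)
  then show ?thesis
    by (simp add: norm_mult)
qed

lemma diagonal_eq_sin:
  assumes "regular_polygon n v"
  obtains R where "\<And>k. k \<le> n \<Longrightarrow> diagonal v k = R * sin (pi * real k / real n)"
proof -
  obtain c a where v: "\<And>k. v k = c + a * cis (2 * pi * real k / real n)" and n: "n \<ge> 3"
    using assms by (auto simp: regular_polygon_def)
  have "diagonal v k = (2 * cmod a) * sin (pi * real k / real n)" if "k \<le> n" for k
  proof -
    have "v 0 - v k = a * (1 - cis (2 * (pi * real k / real n)))"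
      by (simp add: v algebra_simps)
    then have "diagonal v k = cmod a * (2 * \<bar>sin (pi * real k / real n)\<bar>)"
      by (simp only: diagonal_def dist_norm norm_mult norm_one_minus_cis)
    moreover have "sin (pi * real k / real n) \<ge> 0"
      using that n by (intro sin_ge_zero) (auto simp: field_simps)
    ultimately show ?thesis
      by simp
  qed
  then show ?thesis
    by (rule that)
qed

text \<open>
  The argument of the cosine in \<open>sin x - sin y = 2 sin ((x - y) / 2) cos ((x + y) / 2)\<close> is here
  \<open>(i + 1/2) \<pi> / n\<close>, and its complement to \<open>\<pi> / 2 = (q + 1/2) \<pi> / n\<close> is \<open>(q - i) \<pi> / n\<close>.
\<close>

lemma diagonal_gap_odd:
  assumes "regular_polygon n v" "n = 2 * q + 1" "i \<le> q"
  shows "diagonal v (Suc i) - diagonal v i = 2 * sin (pi / (2 * real n)) * diagonal v (q - i)"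
proof -
  obtain R where d: "\<And>k. k \<le> n \<Longrightarrow> diagonal v k = R * sin (pi * real k / real n)"
    using diagonal_eq_sin[OF assms(1)] by blast
  have n: "n \<ge> 3"
    using assms(1) by (simp add: regular_polygon_def)
  define x y where "x = pi * real (Suc i) / real n" and "y = pi * real i / real n"
  have "(x - y) / 2 = pi / (2 * real n)"
    using n by (simp add: x_def y_def field_simps)
  moreover have "(x + y) / 2 = pi / 2 - pi * real (q - i) / real n"
  proof -
    have "real n = 2 * real q + 1" "real (q - i) = real q - real i" "real n \<noteq> 0"
      using assms(2,3) by (simp_all add: of_nat_diff)
    then show ?thesis
      by (simp add: x_def y_def divide_simps) (simp add: algebra_simps)
  qed
  ultimately have "sin x - sin y = 2 * sin (pi / (2 * real n)) * sin (pi * real (q - i) / real n)"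
    by (simp only: sin_diff_sin cos_diff) simp
  moreover have "diagonal v (Suc i) = R * sin x" "diagonal v i = R * sin y"
    using assms(2,3) n by (simp_all add: d x_def y_def)
  ultimately show ?thesis
    using assms(2) by (simp add: d right_diff_distrib[symmetric])
qed

text \<open>
  Multiplied by \<open>2 sin (\<pi> / (2 n))\<close>, the sum, read from the top index \<open>q\<close> downwards, becomes the sum of
  the first \<open>r\<close> gaps, and that telescopes to \<open>d\<^sub>r - d\<^sub>0\<close> with \<open>d\<^sub>0 = 0\<close>.
\<close>

lemma sum_top_diagonals_odd:
  assumes "regular_polygon n v" "n = 2 * q + 1" "r \<le> q + 1"
  shows "diagonal v r = 2 * sin (pi / (2 * real n)) * (\<Sum>i = q + 1 - r..q. diagonal v i)"
proof -
  have "(\<Sum>i = q + 1 - r..q. diagonal v i) = (\<Sum>i<r. diagonal v (q - i))"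
    using assms(3)
    by (intro sum.reindex_bij_witness[of _ "\<lambda>i. q - i" "\<lambda>i. q - i"]) auto
  then have "2 * sin (pi / (2 * real n)) * (\<Sum>i = q + 1 - r..q. diagonal v i)
      = (\<Sum>i<r. diagonal v (Suc i) - diagonal v i)"
    using assms by (simp add: sum_distrib_left diagonal_gap_odd)
  also have "\<dots> = diagonal v r"
    by (subst sum_lessThan_telescope) (simp add: diagonal_def)
  finally show ?thesis ..
qed

theorem theorem3:
  fixes n p q r :: nat and v :: "nat \<Rightarrow> complex"
  assumes "regular_polygon n v"
    and "p > 0" and "q > 0" and "r > 0"
    and "n = p + q + r"
    and "p + r = q + 1"
  shows "(\<forall>j < r - 1. (diagonal v (r - j) - diagonal v (r - j - 1)) / diagonal v (p + j)
            = diagonal v 1 / diagonal v q)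
       \<and> diagonal v 1 / diagonal v q = diagonal v r / (\<Sum>i = p..q. diagonal v i)"
proof -
  define s where "s = 2 * sin (pi / (2 * real n))"
  have n: "n = 2 * q + 1"
    using assms(5,6) by simp
  have pos: "diagonal v i > 0" if "0 < i" "i \<le> q" for i
    using diagonal_pos[OF assms(1), of i] that n by simp
  \<comment> \<open>The ratio \<open>d\<^sub>1 / d\<^sub>q\<close> belongs to the family of gaps because \<open>d\<^sub>0 = 0\<close>.\<close>
  have first: "diagonal v 1 / diagonal v q = s"
    using diagonal_gap_odd[OF assms(1) n, of 0] pos[of q] assms(3)
    by (simp add: s_def diagonal_def)
  have "(diagonal v (r - j) - diagonal v (r - j - 1)) / diagonal v (p + j) = s"
    if "j < r - 1" for j
  proof -
    have "Suc (r - j - 1) = r - j" "q - (r - j - 1) = p + j" "r - j - 1 \<le> q" "p + j \<le> q"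
      using that assms(2,6) by auto
    then show ?thesis
      using diagonal_gap_odd[OF assms(1) n, of "r - j - 1"] pos[of "p + j"] assms(2)
      by (simp add: s_def)
  qed
  moreover have "diagonal v r / (\<Sum>i = p..q. diagonal v i) = s"
  proof -
    have "(\<Sum>i = p..q. diagonal v i) > 0"
      using pos assms(2,4,6) by (intro sum_pos) auto
    moreover have "q + 1 - r = p" "r \<le> q + 1"
      using assms(6) by auto
    ultimately show ?thesis
      using sum_top_diagonals_odd[OF assms(1) n, of r] by (simp add: s_def)
  qed
  ultimately show ?thesis
    using first by simp
qed

end
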